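(* Let $m\ge 2$ be an integer. For all $x,y\in(0,1)$ we have $\dim_H\big(\Lambda(x)\cap\Lambda(y)\big)=1$.
   Context: For $\lambda\in(0,1/m]$, $K_\lambda=\left\{\sum_{i=1}^\infty d_i\lambda^i: d_i\in\{0,1,\ldots,m-1\},\ i\ge 1\right\}\subset\mathbb R$, and for $x\in(0,1)$, $\Lambda(x)=\{\lambda\in(0,1/m]: x\in K_\lambda\}$. $\dim_H$ denotes Hausdorff dimension. *)

theory Defs
  imports "HOL-Analysis.Analysis"
begin

text \<open>
  The \<^term>\<open>s\<close>-th power of the diameter, with the usual conventions \<open>diam {} ^ s = 0\<close> and
  \<open>0 ^ 0 = 1\<close> for nonempty sets (note that \<^prop>\<open>(0::real) powr 0 = 0\<close> in the library). It is only
  meaningful for bounded sets, since \<^const>\<open>diameter\<close> is a real supremum.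
\<close>
definition diam_powr :: "real \<Rightarrow> 'a::metric_space set \<Rightarrow> ennreal" where
  "diam_powr s U =
     (if U = {} then 0 else if s = 0 then 1 else ennreal (diameter U powr s))"

definition hausdorff_premeasure :: "real \<Rightarrow> real \<Rightarrow> 'a::metric_space set \<Rightarrow> ennreal" where
  "hausdorff_premeasure s \<delta> A =
     (INF U \<in> {U :: nat \<Rightarrow> 'a set. A \<subseteq> (\<Union>i. U i) \<and> (\<forall>i. bounded (U i) \<and> diameter (U i) \<le> \<delta>)}.
        (\<Sum>i. diam_powr s (U i)))"

text \<open>The premeasure increases as \<open>\<delta>\<close> decreases, so the limit as \<open>\<delta>\<close> tends to \<open>0\<close> is a supremum.\<close>
definition hausdorff_measure :: "real \<Rightarrow> 'a::metric_space set \<Rightarrow> ennreal" where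
  "hausdorff_measure s A = (SUP \<delta> \<in> {0<..}. hausdorff_premeasure s \<delta> A)"

definition hausdorff_dim :: "'a::metric_space set \<Rightarrow> ennreal" where
  "hausdorff_dim A = (INF s \<in> {s. 0 \<le> s \<and> hausdorff_measure s A = 0}. ennreal s)"

text \<open>
  The value \<^term>\<open>d 0\<close> is not used: digit sequences are indexed by \<open>i \<ge> 1\<close>. The series converges
  for \<open>0 < lam < 1\<close>, in particular for all \<open>lam\<close> occurring in \<open>Lambda_set\<close> when \<open>m \<ge> 2\<close>.
\<close>
definition K_set :: "nat \<Rightarrow> real \<Rightarrow> real set" where
  "K_set m lam =
     {(\<Sum>i. real (d (Suc i)) * lam ^ Suc i) | d :: nat \<Rightarrow> nat. \<forall>i\<ge>1. d i \<in> {0..m - 1}}"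

definition Lambda_set :: "nat \<Rightarrow> real \<Rightarrow> real set" where
  "Lambda_set m x = {lam \<in> {0<..1 / real m}. x \<in> K_set m lam}"

end

theory Submission imports Defs
begin

text \<open>
  The upper bound is trivial, since the set lies in the unit interval. For the lower bound, only
  parameters close to \<open>1 / m\<close> matter. There the digit expansions in base \<open>1 / l\<close> are almost those of an
  integer base: the greedy algorithm for \<open>x\<close> produces a digit that is too large only if some remainder
  falls into a very short interval \<open>[1 - \<kappa>, 1)\<close>. Consequently \<open>Lambda_set m x\<close> contains, near \<open>1 / m\<close>,
  the complement of a family of gaps, one for each finite word of digits
  (\<open>mem_K_set_if_no_gap\<close>). The gap of a word of length \<open>n\<close> has width at most \<open>\<kappa> * l ^ n / x\<close>
  (\<open>gap_diameter\<close>), while an interval of length about \<open>l ^ n\<close> meets only a bounded number of gaps of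
  words of length \<open>n\<close> (\<open>few_gaps_of_length\<close>). So near \<open>1 / m\<close> the gaps are arbitrarily small
  compared with their distances: the set is thick. Since only sums over gaps enter, two such families,
  for \<open>x\<close> and for \<open>y\<close>, are no worse than one.
  
  To see that the intersection has dimension \<open>1\<close>, let \<open>s < 1\<close>, and suppose that it had a cover by sets
  whose \<open>s\<close>-th powers of diameters have a very small sum. The sets of the cover and the gaps are
  obstacles in the same sense, and \<open>potential_game\<close> finds a point that avoids all of them, by
  descending through nested intervals and controlling the sum of the \<open>s\<close>-th powers of the widths
  of the obstacles that are still met. Such a point is in the intersection but not in any set of
  the cover, which is a contradiction. Hence the \<open>s\<close>-dimensional measure is positive
  (\<open>intersection_has_positive_content\<close>, \<open>hausdorff_measure_nonzero_if_content\<close>).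
\<close>

section \<open>Digit sums of finite words\<close>

fun digit_sum :: "real \<Rightarrow> nat list \<Rightarrow> real" where
  "digit_sum l [] = 0"
| "digit_sum l (d # w) = l * (real d + digit_sum l w)"

lemma digit_sum_nonneg: "0 \<le> l \<Longrightarrow> 0 \<le> digit_sum l w"
  by (induction w) auto

lemma digit_sum_append:
  "digit_sum l (w @ [d]) = digit_sum l w + l ^ Suc (length w) * real d"
  by (induction w) (auto simp: algebra_simps)

lemma digit_sum_mono: "0 \<le> l \<Longrightarrow> l \<le> l' \<Longrightarrow> digit_sum l w \<le> digit_sum l' w"
proof (induction w)
  case (Cons d w)
  then show ?case
    by (auto intro!: mult_mono add_nonneg_nonneg digit_sum_nonneg)
qed auto

text \<open>
  By induction the part behind the leading digit \<open>d\<close> contributes at most \<open>1\<close> in units of \<open>l\<close>, so the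
  whole is at most \<open>l * (d + 1) \<le> l * m\<close>.
\<close>
lemma digit_sum_le:
  assumes "0 \<le> l" "real m * l \<le> 1" "set w \<subseteq> {..<m}"
  shows "digit_sum l w + l ^ length w \<le> 1"
  using assms(3)
proof (induction w)
  case (Cons d w)
  then have IH: "digit_sum l w + l ^ length w \<le> 1" and d: "real d + 1 \<le> real m" by auto
  have "digit_sum l (d # w) + l ^ length (d # w) = l * (real d + (digit_sum l w + l ^ length w))"
    by (simp add: algebra_simps)
  also have "\<dots> \<le> l * real m"
    using IH d assms(1) by (intro mult_left_mono) auto
  finally show ?case using assms(2) by (simp add: mult.commute)
qed auto

text \<open>
  At the first position in which two words differ, the tail of the smaller word cannot make up for
  the missing digit. It is this separation that bounds the number of gaps near a given parameter.
\<close>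
lemma digit_sum_separated:
  assumes "0 \<le> l" "real m * l \<le> 1"
    and "set v \<subseteq> {..<m}" "set w \<subseteq> {..<m}" "length v = length w" "v \<noteq> w"
  shows "l ^ length w \<le> \<bar>digit_sum l v - digit_sum l w\<bar>"
  using assms(5,3,4,6)
proof (induction v w rule: list_induct2)
  case (Cons d v e w)
  have gap: "l ^ Suc (length w) \<le> l * (real e + digit_sum l w') - l * (real d + digit_sum l v')"
    if "d < e" "set v' \<subseteq> {..<m}" "length v' = length w" for d e v' w'
  proof -
    have "l ^ length w \<le> 1 - digit_sum l v'"
      using digit_sum_le[OF assms(1,2) that(2)] that(3) by simp
    also have "\<dots> \<le> (real e + digit_sum l w') - (real d + digit_sum l v')"
      using that(1) digit_sum_nonneg[OF assms(1), of w'] by auto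
    finally have "l * l ^ length w \<le> l * ((real e + digit_sum l w') - (real d + digit_sum l v'))"
      using assms(1) by (intro mult_left_mono)
    then show ?thesis by (simp add: algebra_simps)
  qed
  consider "d = e" | "d < e" | "e < d" by linarith
  then show ?case
  proof cases
    case 1
    then have "l ^ length w \<le> \<bar>digit_sum l v - digit_sum l w\<bar>" using Cons by auto
    then have "l * l ^ length w \<le> l * \<bar>digit_sum l v - digit_sum l w\<bar>"
      using assms(1) by (intro mult_left_mono)
    also have "\<dots> = \<bar>l * (digit_sum l v - digit_sum l w)\<bar>" using assms(1) by (simp add: abs_mult)
    finally show ?thesis using 1 by (simp add: algebra_simps)
  next
    case 2
    then show ?thesis using gap[of d e v w] Cons by auto
  next
    case 3
    then show ?thesis using gap[of e d w v] Cons by auto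
  qed
qed auto

text \<open>
  The derivative of \<open>\<Sum> d\<^sub>i * l ^ i\<close> is bounded uniformly in the length of the word, so an interval of
  parameters as short as the separation of the digit sums sees only boundedly many words.
\<close>
lemma digit_sum_lipschitz:
  assumes "0 \<le> l" "l \<le> l'" "l' \<le> 1 / 2" "real m * l' \<le> 1" "set w \<subseteq> {..<m}"
  shows "digit_sum l' w - digit_sum l w \<le> 2 * real m * (l' - l)"
  using assms(5)
proof (induction w)
  case Nil
  then show ?case using assms(2) by auto
next
  case (Cons d w)
  have IH: "digit_sum l' w - digit_sum l w \<le> 2 * real m * (l' - l)" using Cons by auto
  have "digit_sum l' w \<le> 1"
    using digit_sum_le[of l' m w] assms Cons zero_le_power[of l' "length w"] by (auto simp del: zero_le_power)
  moreover have "real d + 1 \<le> real m" using Cons by auto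
  ultimately have d: "real d + digit_sum l' w \<le> real m" by linarith
  have "digit_sum l' (d # w) - digit_sum l (d # w) =
      (l' - l) * (real d + digit_sum l' w) + l * (digit_sum l' w - digit_sum l w)"
    by (simp add: algebra_simps)
  also have "\<dots> \<le> (l' - l) * real m + (1 / 2) * (2 * real m * (l' - l))"
    using d IH assms digit_sum_mono[of l l' w] digit_sum_nonneg[of l' w]
    by (intro add_mono mult_mono) auto
  finally show ?case by (simp add: algebra_simps)
qed

text \<open>
  A nonempty digit sum has no constant term, so it grows at least linearly in \<open>l\<close>: its quotient by
  \<open>l\<close> is increasing. This stands in for a lower bound on the derivative and makes gaps short.
\<close>
lemma digit_sum_scaling:
  assumes "0 < l" "l \<le> l'" "0 \<le> b" "w \<noteq> []"
  shows "l' * (digit_sum l w + l ^ length w * b) \<le> l * (digit_sum l' w + l' ^ length w * b)"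
proof -
  obtain d v where w: "w = d # v" using assms(4) by (cases w) auto
  have "digit_sum l v + l ^ length v * b \<le> digit_sum l' v + l' ^ length v * b"
    using assms by (intro add_mono digit_sum_mono mult_right_mono power_mono) auto
  then have "(l * l') * (real d + digit_sum l v + l ^ length v * b)
      \<le> (l * l') * (real d + digit_sum l' v + l' ^ length v * b)"
    using assms by (intro mult_left_mono) auto
  then show ?thesis by (simp add: w algebra_simps)
qed

section \<open>Gaps and the greedy expansion\<close>

text \<open>
  The parameters for which \<open>w\<close> can be a prefix of the greedy expansion of \<open>x\<close> while the remainder
  \<open>(x - digit_sum l w) / l ^ length w\<close> lies in \<open>[1 - \<kappa>, 1)\<close>. If \<open>l\<close> is close to \<open>1 / m\<close>, a remainder
  below \<open>1 - \<kappa>\<close> is smaller than \<open>m * l\<close>, so that the next greedy digit is again smaller than \<open>m\<close>.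
\<close>
definition gap :: "real \<Rightarrow> real \<Rightarrow> nat list \<Rightarrow> real set" where
  "gap \<kappa> x w = {l. 0 < l \<and> digit_sum l w + l ^ length w * (1 - \<kappa>) \<le> x
                  \<and> x < digit_sum l w + l ^ length w}"

text \<open>
  While \<open>l\<close> runs through a gap, the remainder changes by at most \<open>\<kappa>\<close>, whereas its derivative is
  at least of the order \<open>x / l ^ length w\<close>. So a gap is shorter by a factor of order \<open>\<kappa>\<close> than the
  typical distance between the gaps of words of the same length.
\<close>
lemma gap_diameter:
  assumes "l \<in> gap \<kappa> x w" "l' \<in> gap \<kappa> x w" "l \<le> l'" "l' \<le> 1" "w \<noteq> []" "0 < x" "0 \<le> \<kappa>" "\<kappa> \<le> 1"
  shows "l' - l \<le> \<kappa> * l ^ length w / x"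
proof -
  let ?n = "length w"
  have l: "0 < l" "x < digit_sum l w + l ^ ?n" and l': "digit_sum l' w + l' ^ ?n * (1 - \<kappa>) \<le> x"
    using assms by (auto simp: gap_def)
  have "l' * (x - \<kappa> * l ^ ?n) \<le> l' * (digit_sum l w + l ^ ?n * (1 - \<kappa>))"
    using l assms by (intro mult_left_mono) (auto simp: algebra_simps)
  also have "\<dots> \<le> l * (digit_sum l' w + l' ^ ?n * (1 - \<kappa>))"
    using digit_sum_scaling[of l l' "1 - \<kappa>" w] assms l by auto
  also have "\<dots> \<le> l * x"
    using l l' by (intro mult_left_mono) auto
  finally have "(l' - l) * x \<le> l' * (\<kappa> * l ^ ?n)" by (simp add: algebra_simps)
  also have "\<dots> \<le> 1 * (\<kappa> * l ^ ?n)"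
    using assms l by (intro mult_right_mono) auto
  finally show ?thesis using assms(6) by (simp add: field_simps)
qed

text \<open>
  Iterating \<open>t \<mapsto> frac (t / l)\<close> produces the greedy digits of \<open>x\<close>. By induction the digits stay below
  \<open>m\<close>: as long as they do, the current prefix is an admissible word, and avoiding its gap means that
  the remainder is below \<open>1 - \<kappa> \<le> m * l\<close>.
\<close>
lemma mem_K_set_if_no_gap:
  assumes l: "0 < l" "real m * l \<le> 1" "1 - \<kappa> \<le> real m * l" and m: "2 \<le> m" and x: "0 \<le> x" "x < 1"
    and no_gap: "\<And>w. set w \<subseteq> {..<m} \<Longrightarrow> l \<notin> gap \<kappa> x w"
  shows "x \<in> K_set m l"
proof -
  define r where "r = rec_nat x (\<lambda>_ t. frac (t / l))"
  have r0: "r 0 = x" and rS: "r (Suc n) = frac (r n / l)" for n by (auto simp: r_def)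
  define d where "d n = nat \<lfloor>r (n - 1) / l\<rfloor>" for n
  define W where "W n = map (\<lambda>i. d (Suc i)) [0..<n]" for n
  have r_range: "0 \<le> r n \<and> r n < 1" for n
    by (cases n) (auto simp: r0 rS x frac_lt_1)
  have step: "l * (real (d (Suc n)) + r (Suc n)) = r n" for n
  proof -
    have "0 \<le> \<lfloor>r n / l\<rfloor>" using r_range[of n] l by auto
    then show ?thesis using l by (auto simp: rS d_def frac_def field_simps)
  qed
  have W_len: "length (W n) = n" for n by (simp add: W_def)
  have W_Suc: "W (Suc n) = W n @ [d (Suc n)]" for n by (simp add: W_def)
  have expand: "x = digit_sum l (W n) + l ^ n * r n" for n
  proof (induction n)
    case 0
    then show ?case by (simp add: W_def r0)
  next
    case (Suc n)
    then show ?case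
      by (simp add: W_Suc digit_sum_append W_len step[of n, symmetric] algebra_simps)
  qed
  have digits: "set (W n) \<subseteq> {..<m}" for n
  proof (induction n)
    case 0
    then show ?case by (simp add: W_def)
  next
    case (Suc n)
    have "l ^ n * r n < l ^ n * 1" using r_range[of n] l by (intro mult_strict_left_mono) auto
    then have "x < digit_sum l (W n) + l ^ n" using expand[of n] by simp
    then have "x < digit_sum l (W n) + l ^ n * (1 - \<kappa>)"
      using no_gap[OF Suc] l by (auto simp: gap_def W_len)
    then have "l ^ n * r n < l ^ n * (1 - \<kappa>)" using expand[of n] by simp
    then have "r n < 1 - \<kappa>" using l by simp
    then have "r n / l < real m" using l by (simp add: field_simps)
    then have "d (Suc n) < m" using r_range[of n] l m by (auto simp: d_def) linarith
    then show ?case using Suc by (simp add: W_Suc)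
  qed
  have dm: "d (Suc n) < m" for n using digits[of "Suc n"] by (simp add: W_Suc)
  have partial: "(\<Sum>i<n. real (d (Suc i)) * l ^ Suc i) = digit_sum l (W n)" for n
  proof (induction n)
    case (Suc n)
    then show ?case by (simp add: W_Suc digit_sum_append W_len mult.commute)
  qed (simp add: W_def)
  have digits_eq: "digit_sum l (W n) = x - l ^ n * r n" for n using expand[of n] by linarith
  have "2 * l \<le> real m * l" using m l by (intro mult_right_mono) auto
  then have l_half: "l \<le> 1 / 2" using l by linarith
  have "(\<lambda>n. l ^ n * r n) \<longlonglongrightarrow> 0"
  proof (rule tendsto_sandwich)
    show "\<forall>\<^sub>F n in sequentially. 0 \<le> l ^ n * r n"
      using r_range l by (intro always_eventually allI mult_nonneg_nonneg) auto
    show "\<forall>\<^sub>F n in sequentially. l ^ n * r n \<le> l ^ n"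
      using r_range l by (intro always_eventually allI mult_left_le) (auto simp: less_imp_le)
    show "(\<lambda>n. l ^ n) \<longlonglongrightarrow> 0" using l l_half by (intro LIMSEQ_realpow_zero) auto
    show "(\<lambda>n. 0 :: real) \<longlonglongrightarrow> 0" by simp
  qed
  then have "(\<lambda>n. x - l ^ n * r n) \<longlonglongrightarrow> x - 0" by (intro tendsto_intros)
  then have "(\<lambda>n. \<Sum>i<n. real (d (Suc i)) * l ^ Suc i) \<longlonglongrightarrow> x"
    by (simp only: partial digits_eq diff_0_right)
  then have "x = (\<Sum>i. real (d (Suc i)) * l ^ Suc i)"
    unfolding sums_def[symmetric] by (rule sums_unique)
  moreover have "\<forall>i\<ge>1. d i \<in> {0..m - 1}"
  proof (intro allI impI)
    fix i :: nat assume "1 \<le> i"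
    then show "d i \<in> {0..m - 1}" using dm[of "i - 1"] by auto
  qed
  ultimately show ?thesis unfolding K_set_def by blast
qed

section \<open>Size and number of gaps near the right end\<close>

text \<open>
  The scale \<open>l ^ n\<close> of words of length \<open>n\<close> depends on the parameter \<open>l\<close>, but it is nearly constant on
  intervals whose length is a small multiple of it: this follows from Bernoulli's inequality and
  \<open>n * b ^ n \<le> b\<close>.
\<close>
lemma power_shrink:
  fixes b c h :: real
  assumes "0 < b" "b \<le> 1 / 2" "0 \<le> h" "h \<le> b" "h \<le> c * b ^ n"
  shows "(1 - c) * b ^ n \<le> (b - h) ^ n"
proof -
  have nb: "real n * b ^ n \<le> b"
  proof (cases n)
    case (Suc k)
    have "real n \<le> 2 ^ k"
      using Suc by (metis less_exp Suc_leI of_nat_le_iff of_nat_numeral of_nat_power)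
    then have "real n * b ^ k \<le> 2 ^ k * (1 / 2) ^ k"
      using assms by (intro mult_mono power_mono) auto
    also have "\<dots> = 1" by (simp add: power_mult_distrib[symmetric])
    finally have "b * (real n * b ^ k) \<le> b * 1" using assms by (intro mult_left_mono) auto
    then show ?thesis by (simp add: Suc algebra_simps)
  qed (use assms in simp)
  have c: "0 \<le> c" using assms by (smt (verit) mult_neg_pos zero_less_power)
  have "real n * (h / b) \<le> real n * (c * b ^ n / b)"
    using assms by (intro mult_left_mono divide_right_mono) auto
  also have "\<dots> = c * (real n * b ^ n) / b" by simp
  also have "\<dots> \<le> c * b / b"
    using nb c assms by (intro divide_right_mono mult_left_mono) auto
  finally have "real n * (h / b) \<le> c" using assms by simp
  then have "1 - c \<le> 1 + real n * (- (h / b))" by simp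
  also have "\<dots> \<le> (1 + - (h / b)) ^ n"
    using assms by (intro Bernoulli_inequality) auto
  finally have "(1 - c) * b ^ n \<le> (1 + - (h / b)) ^ n * b ^ n"
    using assms by (intro mult_right_mono) auto
  also have "\<dots> = (b - h) ^ n"
    using assms by (simp add: power_mult_distrib[symmetric] field_simps)
  finally show ?thesis .
qed

text \<open>
  If \<open>l\<close> lies in the gap of \<open>w\<close>, then \<open>x - digit_sum l w\<close> is between \<open>0\<close> and \<open>l ^ n\<close>. Moving the
  parameter from \<open>l\<close> to the left endpoint \<open>a\<close> increases this by at most \<open>a ^ n\<close>, and \<open>l ^ n \<le> 2 * a ^ n\<close>,
  so \<open>x - digit_sum a w\<close> is in \<open>[0, 3 * a ^ n)\<close>. The digit sums at the one parameter \<open>a\<close> are \<open>a ^ n\<close>-separated, which leaves room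
  for three words.
\<close>
lemma few_gaps_of_length:
  assumes a: "0 < a" and L: "0 \<le> L" "real m * (a + L) \<le> 1" "2 * real m * L \<le> a ^ n"
    and grow: "(a + L) ^ n \<le> 2 * a ^ n" and m: "2 \<le> m" and \<kappa>: "\<kappa> \<le> 1"
  shows "card {w. set w \<subseteq> {..<m} \<and> length w = n \<and> gap \<kappa> x w \<inter> {a..a + L} \<noteq> {}} \<le> 3"
proof -
  let ?W = "{w. set w \<subseteq> {..<m} \<and> length w = n \<and> gap \<kappa> x w \<inter> {a..a + L} \<noteq> {}}"
  define F where "F w = \<lfloor>(x - digit_sum a w) / a ^ n\<rfloor>" for w
  have an: "0 < a ^ n" using a by simp
  have ma: "real m * a \<le> 1" using L(1,2) m by (smt (verit) mult_left_mono of_nat_0_le_iff)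
  have "2 * (a + L) \<le> real m * (a + L)" using m a L by (intro mult_right_mono) auto
  also have "\<dots> \<le> 1" by (rule L(2))
  finally have half: "a + L \<le> 1 / 2" by (simp add: field_simps)
  have "F ` ?W \<subseteq> {0..2}"
  proof (rule image_subsetI)
    fix w assume "w \<in> ?W"
    then obtain l where w: "set w \<subseteq> {..<m}" "length w = n" and l: "l \<in> gap \<kappa> x w" "a \<le> l" "l \<le> a + L"
      by auto
    have "real m * l \<le> real m * (a + L)" using l by (intro mult_left_mono) auto
    then have ml: "real m * l \<le> 1" using L by linarith
    have "digit_sum a w \<le> digit_sum l w" using l a by (intro digit_sum_mono) auto
    also have "\<dots> \<le> x"
    proof -
      have "0 \<le> l ^ n * (1 - \<kappa>)" using l a \<kappa> by auto
      then show ?thesis using l(1) w by (auto simp: gap_def)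
    qed
    finally have lower: "digit_sum a w \<le> x" .
    have "x < digit_sum l w + l ^ n" using l(1) w by (auto simp: gap_def)
    also have "\<dots> \<le> digit_sum a w + 2 * real m * (l - a) + (a + L) ^ n"
      using digit_sum_lipschitz[of a l m w] l a half ml w power_mono[of l "a + L" n] by auto
    also have "\<dots> \<le> digit_sum a w + 2 * real m * L + 2 * a ^ n"
      using l grow by (intro add_mono mult_left_mono) auto
    also have "\<dots> \<le> digit_sum a w + 3 * a ^ n" using L by simp
    finally have upper: "x - digit_sum a w < 3 * a ^ n" by simp
    have "0 \<le> (x - digit_sum a w) / a ^ n" "(x - digit_sum a w) / a ^ n < 3"
      using lower upper an by (auto simp: field_simps)
    then show "F w \<in> {0..2}" unfolding F_def by (auto simp: le_floor_iff floor_le_iff)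
  qed
  moreover have "inj_on F ?W"
  proof (rule inj_onI, rule ccontr)
    fix v w assume v: "v \<in> ?W" and w: "w \<in> ?W" and F: "F v = F w" and "v \<noteq> w"
    then have "a ^ n \<le> \<bar>digit_sum a v - digit_sum a w\<bar>"
      using digit_sum_separated[of a m v w] a ma by auto
    moreover have "\<bar>(x - digit_sum a v) / a ^ n - (x - digit_sum a w) / a ^ n\<bar> < 1"
      using F unfolding F_def by linarith
    then have "\<bar>((x - digit_sum a v) - (x - digit_sum a w)) / a ^ n\<bar> < 1"
      by (simp only: diff_divide_distrib)
    then have "\<bar>digit_sum a w - digit_sum a v\<bar> < a ^ n"
      using an by (simp add: field_simps abs_divide)
    ultimately show False by linarith
  qed
  ultimately have "card ?W \<le> card {0..2::int}" by (intro card_inj_on_le) auto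
  then show ?thesis by simp
qed

lemma tendsto_digit_sum:
  "(f \<longlongrightarrow> l) F \<Longrightarrow> ((\<lambda>t. digit_sum (f t) w) \<longlongrightarrow> digit_sum l w) F"
  by (induction w) (auto intro!: tendsto_intros)

text \<open>
  For a fixed word, the gap moves out of the interval \<open>[1 / m - \<delta>, 1 / m]\<close> as \<open>\<delta>\<close> tends to \<open>0\<close>. If the
  remainder of \<open>x\<close> at \<open>1 / m\<close> is smaller than \<open>1\<close>, this is continuity. Otherwise the remainder,
  being decreasing in the parameter, is at least \<open>1\<close> on the whole interval, which is also outside of the gap.
\<close>
lemma gap_leaves_right_end:
  assumes m: "2 \<le> m"
  shows "\<forall>\<^sub>F \<delta> in at_right 0. gap (real m * \<delta>) x w \<inter> {1 / real m - \<delta>..1 / real m} = {}"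
proof (cases "digit_sum (1 / real m) w + (1 / real m) ^ length w \<le> x")
  case True
  have "gap (real m * \<delta>) x w \<inter> {1 / real m - \<delta>..1 / real m} = {}" for \<delta>
  proof -
    have False if l: "l \<in> gap (real m * \<delta>) x w" "l \<le> 1 / real m" for l
    proof -
      have "digit_sum l w + l ^ length w \<le> digit_sum (1 / real m) w + (1 / real m) ^ length w"
        using l by (intro add_mono digit_sum_mono power_mono) (auto simp: gap_def)
      then show False using l True by (auto simp: gap_def)
    qed
    then show ?thesis by auto
  qed
  then show ?thesis by simp
next
  case False
  define g where "g \<delta> = digit_sum (1 / real m - \<delta>) w
    + (1 / real m - \<delta>) ^ length w * (1 - real m * \<delta>)" for \<delta>
  have "(g \<longlongrightarrow> digit_sum (1 / real m - 0) w + (1 / real m - 0) ^ length w * (1 - real m * 0)) (at_right 0)"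
    unfolding g_def by (intro tendsto_intros tendsto_digit_sum)
  then have "\<forall>\<^sub>F \<delta> in at_right 0. x < g \<delta>" using False by (intro order_tendstoD(1)) auto
  moreover have "\<forall>\<^sub>F \<delta> in at_right 0. \<delta> < 1 / real m"
    using m by (intro order_tendstoD(2)[OF tendsto_ident_at]) auto
  ultimately show ?thesis
  proof eventually_elim
    case (elim \<delta>)
    have m\<delta>: "real m * \<delta> \<le> 1" using elim m by (simp add: field_simps)
    have False if l: "l \<in> gap (real m * \<delta>) x w" "1 / real m - \<delta> \<le> l" for l
    proof -
      have "g \<delta> \<le> digit_sum l w + l ^ length w * (1 - real m * \<delta>)"
        unfolding g_def using l elim m\<delta>
        by (intro add_mono digit_sum_mono mult_right_mono power_mono) auto
      then show False using l elim by (auto simp: gap_def)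
    qed
    then show ?case by auto
  qed
qed

lemma sum_shifted_geometric_le:
  fixes q :: real
  assumes "finite F" "\<And>n. n \<in> F \<Longrightarrow> n0 \<le> n" "0 \<le> q" "q < 1"
  shows "(\<Sum>n\<in>F. q ^ (n - n0)) \<le> 1 / (1 - q)"
proof -
  have "inj_on (\<lambda>n. n - n0) F" using assms(2) by (intro inj_onI) (metis le_add_diff_inverse)
  then have "(\<Sum>n\<in>F. q ^ (n - n0)) = (\<Sum>j\<in>(\<lambda>n. n - n0) ` F. q ^ j)"
    by (simp add: sum.reindex)
  also have "\<dots> \<le> (\<Sum>j. q ^ j)"
    using assms by (intro sum_le_suminf summable_geometric) auto
  also have "\<dots> = 1 / (1 - q)" using assms by (intro suminf_geometric) auto
  finally show ?thesis .
qed

text \<open>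
  The total weight of the gaps that meet an interval, for words whose length satisfies \<open>P\<close>. There
  are at most three words of each length for each of \<open>x\<close> and \<open>y\<close>, and the widths decay geometrically
  with the length. So the total is of the order of the largest term, in which \<open>a ^ n\<close> is at most \<open>B\<close>.
\<close>
lemma gap_weight_le:
  fixes x y :: real
  assumes a: "0 < a" and L: "0 < L" "real m * (a + L) \<le> 1" and m: "2 \<le> m"
    and \<kappa>: "0 < \<kappa>" "\<kappa> \<le> 1" and s: "0 < s" and z: "0 < z" "z \<le> x" "z \<le> y" and N: "real m \<le> N"
    and P: "\<And>n. P n \<Longrightarrow> L \<le> a ^ n / (2 * N)" "\<And>n. P n \<Longrightarrow> a ^ n \<le> B" and B: "0 < B"
  defines "Q \<equiv> {(t, w). t \<in> {x, y} \<and> set w \<subseteq> {..<m} \<and> P (length w) \<and> gap \<kappa> t w \<inter> {a..a + L} \<noteq> {}}"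
  shows "finite Q"
    and "(\<Sum>(t, w)\<in>Q. (\<kappa> * (a + L) ^ length w / t) powr s)
      \<le> 6 * (2 / z) powr s / (1 - (1 / 2) powr s) * (\<kappa> * B) powr s"
proof -
  define F where "F = {n. P n}"
  define W where "W t n = {w. set w \<subseteq> {..<m} \<and> length w = n \<and> gap \<kappa> t w \<inter> {a..a + L} \<noteq> {}}" for t n
  have "2 * (a + L) \<le> real m * (a + L)" using m a L by (intro mult_right_mono) auto
  also have "\<dots> \<le> 1" by (rule L(2))
  finally have half: "a + L \<le> 1 / 2" by (simp add: field_simps)
  have N2: "2 \<le> N" using N m by linarith
  have "(\<lambda>n. a ^ n / (2 * N)) \<longlonglongrightarrow> 0 / (2 * N)"
    using a half L N2 by (intro tendsto_divide LIMSEQ_realpow_zero tendsto_const) auto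
  then have "\<forall>\<^sub>F n in sequentially. a ^ n / (2 * N) < L" using L(1) by (intro order_tendstoD(2)) auto
  then obtain n1 where n1: "\<And>n. n \<ge> n1 \<Longrightarrow> a ^ n / (2 * N) < L" by (auto simp: eventually_sequentially)
  have "n < n1" if "n \<in> F" for n
    using P(1)[of n] n1[of n] that by (cases "n1 \<le> n") (auto simp: F_def)
  then have "F \<subseteq> {..<n1}" by blast
  then have fin_F: "finite F" by (rule finite_subset) simp
  have fin_W: "finite (W t n)" for t n
    unfolding W_def by (rule finite_subset[OF _ finite_lists_length_eq[of "{..<m}" n]]) auto
  \<comment> \<open>Admissible lengths are those for which the interval is short compared to \<open>a ^ n\<close>, so that
      \<open>power_shrink\<close> applies with \<open>c = 1 / 2\<close>.\<close>
  have grow: "(a + L) ^ n \<le> 2 * a ^ n" if "n \<in> F" for n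
  proof -
    have "L \<le> a ^ n / (2 * N)" using that P(1) by (auto simp: F_def)
    also have "\<dots> \<le> a ^ n / 2" using N2 a by (intro divide_left_mono) auto
    also have "\<dots> \<le> 1 / 2 * (a + L) ^ n" using a L power_mono[of a "a + L" n] by auto
    finally have "(1 - 1 / 2) * (a + L) ^ n \<le> (a + L - L) ^ n"
      using a L half by (intro power_shrink) auto
    then show ?thesis by simp
  qed
  have card_W: "card (W t n) \<le> 3" if "n \<in> F" for t n
    unfolding W_def
  proof (rule few_gaps_of_length)
    have "2 * real m * L \<le> 2 * N * L" using N L by (intro mult_right_mono) auto
    also have "\<dots> \<le> a ^ n" using that P(1)[of n] N2 by (simp add: F_def field_simps)
    finally show "2 * real m * L \<le> a ^ n" .
  qed (use a L grow[OF that] m \<kappa> in auto)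
  have Q: "Q = Sigma {x, y} (\<lambda>t. \<Union>n\<in>F. W t n)" by (auto simp: Q_def F_def W_def)
  show "finite Q" unfolding Q using fin_F fin_W by auto
  define q where "q = (1 / 2 :: real) powr s"
  have q: "0 \<le> q" "q < 1" using s powr_less_mono2[of s "1/2" 1] by (auto simp: q_def)
  define b where "b = (2 * \<kappa> / z) powr s"
  have b: "0 \<le> b" by (simp add: b_def)
  have decay: "(\<Sum>n\<in>F. (a ^ n) powr s) \<le> B powr s / (1 - q)"
  proof (cases "F = {}")
    case True
    then show ?thesis using q by auto
  next
    case False
    define n0 where "n0 = Min F"
    have n0: "n0 \<in> F" "\<And>n. n \<in> F \<Longrightarrow> n0 \<le> n" using fin_F False by (auto simp: n0_def)
    have "(a ^ n) powr s \<le> B powr s * q ^ (n - n0)" if "n \<in> F" for n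
    proof -
      have "a ^ n = a ^ n0 * a ^ (n - n0)" using n0(2)[OF that] by (simp add: power_add[symmetric])
      also have "\<dots> \<le> B * (1 / 2) ^ (n - n0)"
        using P(2)[of n0] n0(1) a L half B by (intro mult_mono power_mono) (auto simp: F_def)
      finally have "(a ^ n) powr s \<le> (B * (1 / 2) ^ (n - n0)) powr s"
        using a s by (intro powr_mono2) auto
      also have "\<dots> = B powr s * q ^ (n - n0)"
        using B by (simp add: powr_mult q_def powr_power powr_realpow[symmetric] powr_powr mult.commute)
      finally show ?thesis .
    qed
    then have "(\<Sum>n\<in>F. (a ^ n) powr s) \<le> (\<Sum>n\<in>F. B powr s * q ^ (n - n0))" by (intro sum_mono)
    also have "\<dots> = B powr s * (\<Sum>n\<in>F. q ^ (n - n0))" by (simp add: sum_distrib_left)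
    also have "\<dots> \<le> B powr s * (1 / (1 - q))"
      using fin_F n0 q by (intro mult_left_mono sum_shifted_geometric_le) auto
    finally show ?thesis by simp
  qed
  have term_le: "(\<kappa> * (a + L) ^ n / t) powr s \<le> b * (a ^ n) powr s"
    if "t \<in> {x, y}" "n \<in> F" for t n
  proof -
    have t: "0 < t" "z \<le> t" using that z by auto
    have "\<kappa> * (a + L) ^ n / t \<le> \<kappa> * (2 * a ^ n) / z"
      using t z \<kappa> a grow[OF that(2)] by (intro frac_le mult_left_mono) auto
    then have "(\<kappa> * (a + L) ^ n / t) powr s \<le> (2 * \<kappa> / z * a ^ n) powr s"
      using t \<kappa> a L s by (intro powr_mono2) (auto simp: algebra_simps)
    also have "\<dots> = b * (a ^ n) powr s"
      unfolding b_def using \<kappa> z a by (subst powr_mult) auto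
    finally show ?thesis .
  qed
  have inner: "(\<Sum>w\<in>(\<Union>n\<in>F. W t n). (\<kappa> * (a + L) ^ length w / t) powr s) \<le> 3 * b * (B powr s / (1 - q))"
    if t: "t \<in> {x, y}" for t
  proof -
    have "(\<Sum>w\<in>(\<Union>n\<in>F. W t n). (\<kappa> * (a + L) ^ length w / t) powr s) =
        (\<Sum>n\<in>F. \<Sum>w\<in>W t n. (\<kappa> * (a + L) ^ length w / t) powr s)"
      using fin_F fin_W by (intro sum.UNION_disjoint) (auto simp: W_def)
    also have "\<dots> \<le> (\<Sum>n\<in>F. 3 * b * (a ^ n) powr s)"
    proof (rule sum_mono)
      fix n assume n: "n \<in> F"
      have "(\<Sum>w\<in>W t n. (\<kappa> * (a + L) ^ length w / t) powr s) \<le> (\<Sum>w\<in>W t n. b * (a ^ n) powr s)"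
        using term_le[OF t n] by (intro sum_mono) (auto simp: W_def)
      also have "\<dots> = real (card (W t n)) * (b * (a ^ n) powr s)" by simp
      also have "\<dots> \<le> 3 * (b * (a ^ n) powr s)"
        using card_W[OF n] b by (intro mult_right_mono) auto
      finally show "(\<Sum>w\<in>W t n. (\<kappa> * (a + L) ^ length w / t) powr s) \<le> 3 * b * (a ^ n) powr s" by simp
    qed
    also have "\<dots> = 3 * b * (\<Sum>n\<in>F. (a ^ n) powr s)" by (simp add: sum_distrib_left)
    also have "\<dots> \<le> 3 * b * (B powr s / (1 - q))" using decay b by (intro mult_left_mono) auto
    finally show ?thesis .
  qed
  have "(\<Sum>(t, w)\<in>Q. (\<kappa> * (a + L) ^ length w / t) powr s)
      = (\<Sum>t\<in>{x, y}. \<Sum>w\<in>(\<Union>n\<in>F. W t n). (\<kappa> * (a + L) ^ length w / t) powr s)"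
    unfolding Q using fin_F fin_W by (intro sum.Sigma[symmetric]) auto
  also have "\<dots> \<le> real (card {x, y}) * (3 * b * (B powr s / (1 - q)))"
    using inner by (intro sum_bounded_above) auto
  also have "\<dots> \<le> 2 * (3 * b * (B powr s / (1 - q)))"
    using b q card_insert_le_m1[of 2 "{y}" x] by (intro mult_right_mono) (auto simp: card_insert_if)
  also have "\<dots> = 6 * (2 / z) powr s / (1 - q) * (\<kappa> * B) powr s"
    using \<kappa> z B by (simp add: b_def powr_mult powr_divide)
  finally show "(\<Sum>(t, w)\<in>Q. (\<kappa> * (a + L) ^ length w / t) powr s)
      \<le> 6 * (2 / z) powr s / (1 - (1 / 2) powr s) * (\<kappa> * B) powr s" by (simp add: q_def)
qed

section \<open>Avoiding obstacles along nested intervals\<close>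

lemma nn_integral_count_space_Un_le:
  fixes f :: "'i \<Rightarrow> ennreal"
  shows "(\<integral>\<^sup>+i. f i \<partial>count_space (S \<union> T))
    \<le> (\<integral>\<^sup>+i. f i \<partial>count_space S) + (\<integral>\<^sup>+i. f i \<partial>count_space T)"
proof -
  have "(\<integral>\<^sup>+i. f i * indicator (S \<union> T) i \<partial>count_space UNIV)
      \<le> (\<integral>\<^sup>+i. f i * indicator S i + f i * indicator T i \<partial>count_space UNIV)"
    by (intro nn_integral_mono) (auto split: split_indicator)
  also have "\<dots> = (\<integral>\<^sup>+i. f i * indicator S i \<partial>count_space UNIV)
      + (\<integral>\<^sup>+i. f i * indicator T i \<partial>count_space UNIV)"
    by (intro nn_integral_add) auto
  finally show ?thesis by (simp add: nn_integral_count_space_indicator)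
qed

text \<open>
  A sequence of nested intervals can be chosen so as to avoid many obstacles \<open>A i\<close> of width \<open>\<rho> i\<close>,
  even if new obstacles, which may depend on the intervals chosen so far, keep appearing. The
  \<open>s\<close>-weight of the obstacles that meet the current interval \<open>J\<close> serves as a potential, and the
  invariant is that the potential is at most \<open>(|J| / N) ^ s\<close>. Then each obstacle that meets \<open>J\<close> is no
  wider than one of the \<open>N\<close> equal parts of \<open>J\<close>, and so it meets at most three of them. Hence the
  average potential of a part is at most \<open>3 / N\<close> times the old one, and since \<open>6 * N ^ s < N\<close> this is
  less than half of what the invariant permits for the parts. The other half is available for
  new obstacles. As the intervals shrink, the potential tends to \<open>0\<close>, so an obstacle of
  positive width cannot meet all of them.
\<close>
lemma potential_game:
  fixes A :: "'i \<Rightarrow> real set" and \<rho> :: "'i \<Rightarrow> real" and New :: "nat \<Rightarrow> real \<Rightarrow> 'i set"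
  assumes N: "6 * real N powr s < real N" and s: "0 < s" and L: "0 < L"
    and \<rho>_pos: "\<And>k a i. a0 \<le> a \<Longrightarrow> a + L / real N ^ k \<le> a0 + L \<Longrightarrow> i \<in> New k a \<Longrightarrow> 0 < \<rho> i"
    and width: "\<And>k a i u v. a0 \<le> a \<Longrightarrow> a + L / real N ^ k \<le> a0 + L \<Longrightarrow> i \<in> New k a \<Longrightarrow>
           u \<in> A i \<Longrightarrow> v \<in> A i \<Longrightarrow> u \<le> v \<Longrightarrow> v - u \<le> \<rho> i"
    and new_0: "(\<integral>\<^sup>+i. ennreal (\<rho> i powr s) \<partial>count_space (New 0 a0)) \<le> ennreal ((L / real N) powr s)"
    and new_Suc: "\<And>k a. a0 \<le> a \<Longrightarrow> a + L / real N ^ Suc k \<le> a0 + L \<Longrightarrow>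
           (\<integral>\<^sup>+i. ennreal (\<rho> i powr s) \<partial>count_space (New (Suc k) a))
             \<le> ennreal ((L / real N ^ Suc (Suc k)) powr s / 2)"
  obtains a z where "a 0 = a0" "\<And>k. a k \<le> a (Suc k)"
    "\<And>k. a (Suc k) + L / real N ^ Suc k \<le> a k + L / real N ^ k"
    "\<And>k. z \<in> {a k..a k + L / real N ^ k}" "\<And>k i. i \<in> New k (a k) \<Longrightarrow> z \<notin> A i"
proof -
  define len where "len k = L / real N ^ k" for k
  define pot where "pot S J = (\<integral>\<^sup>+i. ennreal (\<rho> i powr s) * indicator {i \<in> S. A i \<inter> J \<noteq> {}} i
      \<partial>count_space UNIV)" for S and J :: "real set"
  have N_pos: "0 < N" using N by (cases N) auto
  have N1: "1 < real N"
  proof -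
    have "1 powr s \<le> real N powr s" using N_pos s by (intro powr_mono2) auto
    then show ?thesis using N by simp
  qed
  have len_pos: "0 < len k" for k using L N_pos by (simp add: len_def)
  have len_Suc: "len k = real N * len (Suc k)" for k using N_pos by (simp add: len_def)
  have count_space_restrict: "(\<integral>\<^sup>+i. f i * indicator S i \<partial>count_space UNIV) = (\<integral>\<^sup>+i. f i \<partial>count_space S)"
    for f :: "'i \<Rightarrow> ennreal" and S by (simp add: nn_integral_count_space_indicator)
  have pot_Un: "pot (S \<union> T) J \<le> pot S J + (\<integral>\<^sup>+i. ennreal (\<rho> i powr s) \<partial>count_space T)" for S T J
  proof -
    have "pot (S \<union> T) J \<le> (\<integral>\<^sup>+i. ennreal (\<rho> i powr s) * indicator {i \<in> S. A i \<inter> J \<noteq> {}} i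
        + ennreal (\<rho> i powr s) * indicator T i \<partial>count_space UNIV)"
      unfolding pot_def by (intro nn_integral_mono) (auto split: split_indicator)
    also have "\<dots> = pot S J + (\<integral>\<^sup>+i. ennreal (\<rho> i powr s) \<partial>count_space T)"
      unfolding pot_def by (subst nn_integral_add) (auto simp: count_space_restrict)
    finally show ?thesis .
  qed
  have weight_le_pot: "ennreal (\<rho> i powr s) \<le> pot S J" if "i \<in> S" "A i \<inter> J \<noteq> {}" for i S J
  proof -
    have "pot S J = (\<integral>\<^sup>+i. ennreal (\<rho> i powr s) \<partial>count_space {i \<in> S. A i \<inter> J \<noteq> {}})"
      unfolding pot_def by (rule count_space_restrict)
    then show ?thesis using that
      by (metis (mono_tags, lifting) mem_Collect_eq nn_integral_ge_point)
  qed
  \<comment> \<open>A state consists of the left endpoint of the current interval and of the set of all obstacles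
      that have appeared so far.\<close>
  define ok where "ok k st \<longleftrightarrow> (case st of (a, S) \<Rightarrow> a0 \<le> a \<and> a + len k \<le> a0 + L \<and>
      (\<forall>i\<in>S. 0 < \<rho> i \<and> (\<forall>u v. u \<in> A i \<longrightarrow> v \<in> A i \<longrightarrow> u \<le> v \<longrightarrow> v - u \<le> \<rho> i)) \<and>
      pot S {a..a + len k} \<le> ennreal (len (Suc k) powr s))" for k st
  define move where "move k st st' \<longleftrightarrow> (case st of (a, S) \<Rightarrow> case st' of (a', S') \<Rightarrow>
      a \<le> a' \<and> a' + len (Suc k) \<le> a + len k \<and> S' = S \<union> New (Suc k) a')" for k :: nat and st st'
  have new_ok: "0 < \<rho> i \<and> (\<forall>u v. u \<in> A i \<longrightarrow> v \<in> A i \<longrightarrow> u \<le> v \<longrightarrow> v - u \<le> \<rho> i)"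
    if "a0 \<le> a" "a + len k \<le> a0 + L" "i \<in> New k a" for i k a
    using that \<rho>_pos[of a k i] width[of a k i] by (auto simp: len_def)
  have start: "ok 0 (a0, New 0 a0)"
  proof -
    have "pot ({} \<union> New 0 a0) {a0..a0 + len 0} \<le> 0 + ennreal ((L / real N) powr s)"
      by (rule order_trans[OF pot_Un]) (use new_0 in \<open>simp add: pot_def\<close>)
    then show ?thesis using new_ok[of a0 0] by (auto simp: ok_def len_def)
  qed
  have step: "\<exists>st'. ok (Suc k) st' \<and> move k st st'" if "ok k st" for k st
  proof -
    obtain a S where st: "st = (a, S)" by (cases st)
    have a: "a0 \<le> a" "a + len k \<le> a0 + L" and S_pos: "\<And>i. i \<in> S \<Longrightarrow> 0 < \<rho> i"
      and S_width: "\<And>i u v. i \<in> S \<Longrightarrow> u \<in> A i \<Longrightarrow> v \<in> A i \<Longrightarrow> u \<le> v \<Longrightarrow> v - u \<le> \<rho> i"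
      and pot_a: "pot S {a..a + len k} \<le> ennreal (len (Suc k) powr s)"
      using that by (auto simp: ok_def st)
    define l where "l = len (Suc k)"
    have l: "0 < l" "len k = N * l" using len_pos[of "Suc k"] len_Suc[of k] by (auto simp: l_def)
    define C where "C j = {a + real j * l..a + real j * l + l}" for j :: nat
    define h where "h = len (Suc (Suc k)) powr s / 2"
    have child: "a + real j * l + l \<le> a + len k" if "j < N" for j
    proof -
      have "(real j + 1) * l \<le> real N * l" using that l by (intro mult_right_mono) auto
      then show ?thesis using l by (simp add: algebra_simps)
    qed
    have hits: "card {j. j < N \<and> A i \<inter> C j \<noteq> {}} \<le> 3" if i: "i \<in> S" "A i \<inter> {a..a + len k} \<noteq> {}" for i
    proof (cases "{j. j < N \<and> A i \<inter> C j \<noteq> {}} = {}")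
      case False
      have "ennreal (\<rho> i powr s) \<le> ennreal (l powr s)"
        using order_trans[OF weight_le_pot[OF i] pot_a] by (simp add: l_def)
      then have "\<rho> i powr s \<le> l powr s" by simp
      then have small: "\<rho> i \<le> l" using powr_less_mono2[of s l "\<rho> i"] s l by force
      define j0 where "j0 = Min {j. j < N \<and> A i \<inter> C j \<noteq> {}}"
      have j0: "j0 \<in> {j. j < N \<and> A i \<inter> C j \<noteq> {}}" unfolding j0_def using False by (intro Min_in) auto
      have "{j. j < N \<and> A i \<inter> C j \<noteq> {}} \<subseteq> {j0..j0 + 2}"
      proof
        fix j assume j: "j \<in> {j. j < N \<and> A i \<inter> C j \<noteq> {}}"
        then have ge: "j0 \<le> j" unfolding j0_def by (intro Min_le) auto
        obtain u v where u: "u \<in> A i" "u \<in> C j0" and v: "v \<in> A i" "v \<in> C j" using j j0 by blast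
        have "v - u \<le> l"
        proof (cases "u \<le> v")
          case True
          then show ?thesis using S_width[OF i(1) u(1) v(1)] small by linarith
        qed (use l in linarith)
        then have "real j * l \<le> (real j0 + 2) * l" using u v by (simp add: C_def algebra_simps)
        then have "real j \<le> real j0 + 2" using l by simp
        then show "j \<in> {j0..j0 + 2}" using ge by auto
      qed
      then have "card {j. j < N \<and> A i \<inter> C j \<noteq> {}} \<le> card {j0..j0 + 2}" by (intro card_mono) auto
      then show ?thesis by simp
    next
      case True
      show ?thesis by (simp only: True card.empty)
    qed
    have total: "(\<Sum>j<N. pot S (C j)) \<le> 3 * pot S {a..a + len k}"
    proof -
      have "(\<Sum>j<N. pot S (C j)) = (\<integral>\<^sup>+i. (\<Sum>j<N. ennreal (\<rho> i powr s) *
          indicator {i \<in> S. A i \<inter> C j \<noteq> {}} i) \<partial>count_space UNIV)"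
        unfolding pot_def by (subst nn_integral_sum) auto
      also have "\<dots> \<le> (\<integral>\<^sup>+i. 3 * (ennreal (\<rho> i powr s) *
          indicator {i \<in> S. A i \<inter> {a..a + len k} \<noteq> {}} i) \<partial>count_space UNIV)"
      proof (intro nn_integral_mono)
        fix i
        show "(\<Sum>j<N. ennreal (\<rho> i powr s) * indicator {i \<in> S. A i \<inter> C j \<noteq> {}} i)
            \<le> 3 * (ennreal (\<rho> i powr s) * indicator {i \<in> S. A i \<inter> {a..a + len k} \<noteq> {}} i)"
        proof (cases "i \<in> S \<and> A i \<inter> {a..a + len k} \<noteq> {}")
          case True
          have "(\<Sum>j<N. ennreal (\<rho> i powr s) * indicator {i \<in> S. A i \<inter> C j \<noteq> {}} i)
              = (\<Sum>j\<in>{j. j < N \<and> A i \<inter> C j \<noteq> {}}. ennreal (\<rho> i powr s))"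
            using True by (intro sum.mono_neutral_cong_right) (auto split: split_indicator)
          also have "\<dots> = of_nat (card {j. j < N \<and> A i \<inter> C j \<noteq> {}}) * ennreal (\<rho> i powr s)" by simp
          also have "\<dots> \<le> of_nat 3 * ennreal (\<rho> i powr s)"
            using hits True by (intro mult_right_mono) (auto simp del: of_nat_numeral)
          finally show ?thesis using True by simp
        next
          case False
          have "C j \<subseteq> {a..a + len k}" if "j < N" for j
            using child[OF that] l by (auto simp: C_def intro: order_trans[rotated])
          then have "(\<Sum>j<N. ennreal (\<rho> i powr s) * indicator {i \<in> S. A i \<inter> C j \<noteq> {}} i) = 0"
            using False by (intro sum.neutral) (auto split: split_indicator)
          then show ?thesis by (simp only: zero_le)
        qed
      qed
      also have "\<dots> = 3 * pot S {a..a + len k}" unfolding pot_def by (subst nn_integral_cmult) auto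
      finally show ?thesis .
    qed
    have h_nonneg: "0 \<le> h" by (simp add: h_def)
    \<comment> \<open>If every part had a potential above \<open>h\<close>, then the sum over the parts would violate the bound \<open>total\<close>.\<close>
    have "\<exists>j<N. pot S (C j) \<le> ennreal h"
    proof (rule ccontr)
      assume *: "\<not> ?thesis"
      have pw: "len (Suc k) powr s = real N powr s * len (Suc (Suc k)) powr s"
        using len_Suc[of "Suc k"] len_pos[of "Suc (Suc k)"] by (simp add: powr_mult)
      have "ennreal (N * h) = (\<Sum>j<N. ennreal h)"
        by (simp add: ennreal_mult[OF _ h_nonneg] ennreal_of_nat_eq_real_of_nat)
      also have "\<dots> \<le> (\<Sum>j<N. pot S (C j))" using * by (intro sum_mono) force
      also have "\<dots> \<le> 3 * ennreal (len (Suc k) powr s)"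
        using total pot_a by (meson mult_left_mono order_trans zero_le)
      also have "\<dots> = ennreal (3 * len (Suc k) powr s)"
        by (subst ennreal_mult) auto
      finally have "N * h \<le> 3 * len (Suc k) powr s" by (simp add: ennreal_le_iff)
      then have "real N * len (Suc (Suc k)) powr s \<le> (6 * N powr s) * len (Suc (Suc k)) powr s"
        by (simp add: h_def pw)
      then show False using N len_pos[of "Suc (Suc k)"] by simp
    qed
    then obtain j where j: "j < N" "pot S (C j) \<le> ennreal h" by blast
    define a' where "a' = a + real j * l"
    have a': "a \<le> a'" "a' + len (Suc k) \<le> a + len k"
      using child[OF j(1)] l by (auto simp: a'_def l_def[symmetric])
    have "pot (S \<union> New (Suc k) a') {a'..a' + len (Suc k)} \<le> ennreal h + ennreal h"
    proof (rule order_trans[OF pot_Un add_mono])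
      show "pot S {a'..a' + len (Suc k)} \<le> ennreal h" using j(2) by (simp add: C_def a'_def l_def)
      show "(\<integral>\<^sup>+ i. ennreal (\<rho> i powr s) \<partial>count_space (New (Suc k) a')) \<le> ennreal h"
        using new_Suc[of a' k] a a' by (simp add: h_def len_def)
    qed
    also have "\<dots> = ennreal (len (Suc (Suc k)) powr s)"
      by (simp add: h_def ennreal_plus[symmetric] del: ennreal_plus)
    finally have "ok (Suc k) (a', S \<union> New (Suc k) a')"
      using a a' S_pos S_width new_ok[of a' "Suc k"] by (auto simp: ok_def)
    moreover have "move k st (a', S \<union> New (Suc k) a')" using a' by (auto simp: move_def st)
    ultimately show ?thesis by blast
  qed
  have "\<exists>f. f 0 = (a0, New 0 a0) \<and> (\<forall>k. ok k (f k)) \<and> (\<forall>k. move k (f k) (f (Suc k)))"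
    using dependent_nat_choice[of "\<lambda>k st. ok k st \<and> (k = 0 \<longrightarrow> st = (a0, New 0 a0))" move] start step
    by (metis nat.distinct(1))
  then obtain f where f: "f 0 = (a0, New 0 a0)" "\<And>k. ok k (f k)" "\<And>k. move k (f k) (f (Suc k))"
    by blast
  define a where "a k = fst (f k)" for k
  define S where "S k = snd (f k)" for k
  have f_eq: "f k = (a k, S k)" for k by (simp add: a_def S_def)
  have mono: "a k \<le> a (Suc k)" "a (Suc k) + len (Suc k) \<le> a k + len k"
    and S_Suc: "S (Suc k) = S k \<union> New (Suc k) (a (Suc k))" for k
    using f(3)[of k] by (auto simp: move_def f_eq)
  have pot_k: "pot (S k) {a k..a k + len k} \<le> ennreal (len (Suc k) powr s)"
    and S_pos: "i \<in> S k \<Longrightarrow> 0 < \<rho> i" for k i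
    using f(2)[of k] by (auto simp: ok_def f_eq)
  have inc: "incseq a" using mono by (intro incseq_SucI)
  have dec: "decseq (\<lambda>k. a k + len k)" using mono by (intro decseq_SucI)
  have ab: "a j \<le> a k + len k" for j k
  proof -
    have "a j \<le> a (max j k)" using inc by (simp add: incseqD)
    also have "\<dots> \<le> a (max j k) + len (max j k)" using len_pos[of "max j k"] by simp
    also have "\<dots> \<le> a k + len k" using decseqD[OF dec, of k "max j k"] by simp
    finally show ?thesis .
  qed
  define z where "z = (SUP j. a j)"
  have bdd: "bdd_above (range a)" using ab[of _ 0] by (auto simp: bdd_above_def)
  have z: "z \<in> {a k..a k + len k}" for k
    unfolding z_def using bdd ab by (auto intro: cSUP_upper cSUP_least)
  have New_sub: "New k (a k) \<subseteq> S k" for k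
  proof (cases k)
    case 0
    then show ?thesis using f(1) by (simp add: f_eq)
  qed (simp add: S_Suc)
  have S_inc: "S k \<subseteq> S (k + j)" for k j
    by (induction j) (auto simp: S_Suc)
  have avoid: "z \<notin> A i" if i: "i \<in> New k (a k)" for i k
  proof
    assume zi: "z \<in> A i"
    have "\<rho> i \<le> len (Suc (k + j))" for j
    proof -
      have "i \<in> S (k + j)" using i New_sub S_inc by blast
      moreover have "A i \<inter> {a (k + j)..a (k + j) + len (k + j)} \<noteq> {}" using zi z by blast
      ultimately have "ennreal (\<rho> i powr s) \<le> ennreal (len (Suc (k + j)) powr s)"
        using order_trans[OF weight_le_pot pot_k] by blast
      then have "\<rho> i powr s \<le> len (Suc (k + j)) powr s" by simp
      then show ?thesis
        using powr_less_mono2[of s "len (Suc (k + j))" "\<rho> i"] s len_pos[of "Suc (k + j)"] by force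
    qed
    moreover have "(\<lambda>j. len (Suc (k + j))) \<longlonglongrightarrow> 0"
    proof -
      have "(\<lambda>n. L * (1 / real N) ^ n) \<longlonglongrightarrow> L * 0"
        using N1 by (intro tendsto_mult tendsto_const LIMSEQ_realpow_zero) auto
      then have "len \<longlonglongrightarrow> 0" by (simp add: len_def[abs_def] power_divide)
      then show ?thesis using LIMSEQ_ignore_initial_segment[of len 0 "Suc k"] by (simp add: add.commute)
    qed
    ultimately have "\<rho> i \<le> 0" by (intro LIMSEQ_le_const) auto
    moreover have "0 < \<rho> i" using S_pos New_sub i by blast
    ultimately show False by simp
  qed
  show thesis
  proof (rule that)
    show "a 0 = a0" using f(1) by (simp add: a_def)
  qed (use mono z avoid in \<open>auto simp: len_def\<close>)
qed

section \<open>Hausdorff content, measure and dimension on the line\<close>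

text \<open>
  The \<open>s\<close>-dimensional Hausdorff content of \<open>E\<close> exceeds \<open>\<theta>\<close>, where the sets of a cover are weighted by
  upper bounds \<open>r i\<close> of their diameters. As these bounds are positive, even a single point
  has a positive weight, which is what \<open>potential_game\<close> requires of an obstacle.
\<close>
definition content_exceeds :: "real \<Rightarrow> real set \<Rightarrow> real \<Rightarrow> bool" where
  "content_exceeds s E \<theta> \<longleftrightarrow> (\<forall>(U :: nat \<Rightarrow> real set) r.
     (\<forall>i. 0 < r i) \<longrightarrow> (\<forall>i. \<forall>u\<in>U i. \<forall>v\<in>U i. u \<le> v \<longrightarrow> v - u \<le> r i) \<longrightarrow> E \<subseteq> (\<Union>i. U i) \<longrightarrow>
     ennreal \<theta> < (\<Sum>i. ennreal (r i powr s)))"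

text \<open>
  Cover the unit interval by \<open>n\<close> intervals of length \<open>1 / n\<close>: for \<open>s > 1\<close> the sum of the \<open>s\<close>-th powers
  of their lengths is \<open>n powr (1 - s)\<close>, which tends to \<open>0\<close>.
\<close>
lemma hausdorff_dim_le_1:
  fixes E :: "real set"
  assumes "E \<subseteq> {0..1}"
  shows "hausdorff_dim E \<le> 1"
proof -
  have null: "hausdorff_measure s E = 0" if s: "1 < s" for s
  proof -
    have "hausdorff_premeasure s \<delta> E = 0" if \<delta>: "0 < \<delta>" for \<delta>
    proof -
      have le: "hausdorff_premeasure s \<delta> E \<le> ennreal (real n powr (1 - s))" if n: "1 / \<delta> \<le> real n" for n
      proof -
        have n0: "0 < n" using n \<delta> by (cases n) (auto simp: field_simps)
        define U where "U i = (if i < n then {real i / n..(real i + 1) / n} else {})" for i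
        have diam: "diameter (U i) = (if i < n then 1 / n else 0)" for i
          using n0 by (auto simp: U_def diameter_closed_interval field_simps)
        have "E \<subseteq> (\<Union>i. U i)"
        proof
          fix e assume "e \<in> E"
          then have e: "0 \<le> e" "e \<le> 1" using assms by auto
          define i where "i = (if e = 1 then n - 1 else nat \<lfloor>e * n\<rfloor>)"
          have "e \<in> U i"
          proof (cases "e = 1")
            case True
            then show ?thesis using n0 by (auto simp: U_def i_def field_simps)
          next
            case False
            have "e * n < n" using e False n0 by simp
            then have "\<lfloor>e * n\<rfloor> < int n" by (simp add: floor_less_iff)
            then have "i < n" using False n0 by (simp add: i_def nat_less_iff)
            moreover have "real i = of_int \<lfloor>e * n\<rfloor>" using False e by (simp add: i_def)
            then have "real i \<le> e * n" "e * n \<le> real i + 1" by linarith+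
            ultimately show ?thesis using n0 by (simp add: U_def field_simps)
          qed
          then show "e \<in> (\<Union>i. U i)" by blast
        qed
        moreover have "bounded (U i) \<and> diameter (U i) \<le> \<delta>" for i
          using n n0 \<delta> by (auto simp: diam) (auto simp: U_def field_simps)
        ultimately have "hausdorff_premeasure s \<delta> E \<le> (\<Sum>i. diam_powr s (U i))"
          unfolding hausdorff_premeasure_def by (intro INF_lower) auto
        also have "\<dots> = (\<Sum>i<n. diam_powr s (U i))"
          by (intro suminf_finite) (auto simp: diam_powr_def U_def)
        also have "\<dots> = (\<Sum>i<n. ennreal ((1 / n) powr s))"
        proof (rule sum.cong)
          fix i assume "i \<in> {..<n}"
          then have "U i \<noteq> {}" using n0 by (auto simp: U_def divide_right_mono)
          then show "diam_powr s (U i) = ennreal ((1 / n) powr s)"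
            using s \<open>i \<in> {..<n}\<close> by (simp add: diam_powr_def diam)
        qed simp
        also have "\<dots> = ennreal (real n * (1 / n) powr s)"
          by (simp add: ennreal_mult ennreal_of_nat_eq_real_of_nat)
        also have "real n * (1 / n) powr s = real n powr (1 - s)"
          using n0 by (simp add: powr_divide powr_diff)
        finally show ?thesis .
      qed
      have "(\<lambda>n. ennreal (real n powr (1 - s))) \<longlonglongrightarrow> ennreal 0"
        using s by (intro tendsto_ennrealI tendsto_neg_powr filterlim_real_sequentially) auto
      moreover have "\<forall>\<^sub>F n in sequentially. hausdorff_premeasure s \<delta> E \<le> ennreal (real n powr (1 - s))"
      proof -
        obtain n0 where "1 / \<delta> \<le> real n0" using real_arch_simple by blast
        then show ?thesis
          unfolding eventually_sequentially using le by (intro exI[of _ n0]) (meson of_nat_le_iff order_trans)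
      qed
      ultimately have "hausdorff_premeasure s \<delta> E \<le> ennreal 0"
        by (rule tendsto_lowerbound) simp
      then show ?thesis by simp
    qed
    then show ?thesis by (simp add: hausdorff_measure_def)
  qed
  have "hausdorff_dim E \<le> ennreal s" if "1 < s" for s
    unfolding hausdorff_dim_def using null[OF that] that by (intro INF_lower) auto
  then have "hausdorff_dim E \<le> ennreal 1 + ennreal e" if "0 < e" for e
    using that by (metis ennreal_plus less_add_same_cancel1 less_eq_real_def zero_le_one)
  then have "hausdorff_dim E \<le> ennreal 1" by (rule ennreal_le_epsilon)
  then show ?thesis by simp
qed

text \<open>
  If the measure vanishes, there are covers by sets of diameter at most \<open>1\<close> with an arbitrarily small
  sum, and for such sets the \<open>t\<close>-th power is dominated by the \<open>s\<close>-th power. The exponent \<open>t\<close> may be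
  larger than \<open>s\<close> so that the case \<open>s = 0\<close>, in which the powers of diameters count nonempty sets, is
  covered by a positive exponent.
\<close>
lemma hausdorff_measure_nonzero_if_content:
  fixes E :: "real set"
  assumes s: "0 \<le> s" "s \<le> t" "0 < t" and \<theta>: "0 < \<theta>" and content: "content_exceeds t E \<theta>"
  shows "hausdorff_measure s E \<noteq> 0"
proof
  assume null: "hausdorff_measure s E = 0"
  have "hausdorff_premeasure s 1 E \<le> hausdorff_measure s E"
    unfolding hausdorff_measure_def by (intro SUP_upper) auto
  then have "hausdorff_premeasure s 1 E < ennreal (\<theta> / 2)" using null \<theta> by simp
  then obtain U :: "nat \<Rightarrow> real set" where U: "E \<subseteq> (\<Union>i. U i)" "\<And>i. bounded (U i)" "\<And>i. diameter (U i) \<le> 1"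
    and sum_U: "(\<Sum>i. diam_powr s (U i)) < ennreal (\<theta> / 2)"
    unfolding hausdorff_premeasure_def INF_less_iff by auto
  \<comment> \<open>Enlarging the \<open>t\<close>-th powers by a summable sequence makes all weights positive.\<close>
  define e where "e i = \<theta> / 2 * (1 / 2) ^ Suc i" for i
  define r where "r i = (diameter (U i) powr t + e i) powr (1 / t)" for i
  have e: "0 < e i" for i using \<theta> by (simp add: e_def)
  have r_pos: "0 < r i" for i using e[of i] powr_ge_zero[of "diameter (U i)" t] unfolding r_def
    by (smt (verit) powr_gt_zero)
  have diam_nn: "0 \<le> diameter (U i)" for i using U(2) by (rule diameter_ge_0)
  have width: "v - u \<le> r i" if "u \<in> U i" "v \<in> U i" "u \<le> v" for i u v
  proof -
    have "v - u \<le> diameter (U i)"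
      using diameter_bounded_bound[OF U(2) that(2,1)] that(3) by (simp add: dist_real_def)
    also have "\<dots> = (diameter (U i) powr t) powr (1 / t)" using s diam_nn[of i] by (simp add: powr_powr)
    also have "\<dots> \<le> r i" unfolding r_def using s less_imp_le[OF e[of i]] by (intro powr_mono2) auto
    finally show ?thesis .
  qed
  have r_powr: "ennreal (r i powr t) \<le> diam_powr s (U i) + ennreal (e i)" for i
  proof -
    have "ennreal (r i powr t) = ennreal (diameter (U i) powr t) + ennreal (e i)"
      using s e[of i] by (simp add: r_def powr_powr)
    also have "ennreal (diameter (U i) powr t) \<le> diam_powr s (U i)"
    proof (cases "U i = {}")
      case False
      have "diameter (U i) powr t \<le> (if s = 0 then 1 else diameter (U i) powr s)"
      proof (cases "diameter (U i) = 0")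
        case False
        then have "0 < diameter (U i)" using diam_nn[of i] by simp
        then have "diameter (U i) powr t \<le> diameter (U i) powr s" using U(3) s by (intro powr_mono') auto
        then show ?thesis using \<open>0 < diameter (U i)\<close> by auto
      qed (use s in auto)
      then show ?thesis using False by (auto simp: diam_powr_def intro!: ennreal_leI split: if_splits)
    qed (simp add: diam_powr_def)
    finally show ?thesis by (simp add: add_right_mono)
  qed
  have "(\<Sum>i. ennreal (r i powr t)) \<le> (\<Sum>i. diam_powr s (U i) + ennreal (e i))"
    using r_powr by (intro suminf_le) auto
  also have "\<dots> = (\<Sum>i. diam_powr s (U i)) + (\<Sum>i. ennreal (e i))"
    by (intro suminf_add[symmetric]) auto
  also have "(\<Sum>i. ennreal (e i)) = ennreal (\<theta> / 2)"
  proof -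
    have "e sums (\<theta> / 2 * 1)" unfolding e_def[abs_def] by (intro sums_mult power_half_series)
    then show ?thesis using e by (intro suminf_ennreal_eq) (auto intro: less_imp_le)
  qed
  also have "(\<Sum>i. diam_powr s (U i)) + ennreal (\<theta> / 2) \<le> ennreal (\<theta> / 2) + ennreal (\<theta> / 2)"
    using sum_U by (intro add_right_mono) auto
  also have "\<dots> = ennreal \<theta>" using \<theta> by (simp flip: ennreal_plus)
  finally have "(\<Sum>i. ennreal (r i powr t)) \<le> ennreal \<theta>" .
  moreover have "ennreal \<theta> < (\<Sum>i. ennreal (r i powr t))"
    using content r_pos width U(1) unfolding content_exceeds_def by blast
  ultimately show False by simp
qed

section \<open>Parameters common to two points\<close>

text \<open>
  The point that \<open>potential_game\<close> produces inside \<open>[1 / m - \<delta>, 1 / m]\<close> avoids the sets of a hypothetical cover of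
  small weight, which are all present from the beginning, and the gaps of \<open>x\<close> and of \<open>y\<close>. The gaps of
  words of length \<open>n\<close> appear as soon as the current interval \<open>[a, a + len k]\<close> is shorter than
  \<open>a ^ n / (2 * N)\<close>, when at most six of them meet it. Three ranges of \<open>n\<close> are treated differently.
  For \<open>n < n1\<close> no gap meets the initial interval, by the choice of \<open>\<delta>\<close>. Lengths \<open>n \<ge> n1\<close> that are
  due at the start are harmless because \<open>\<kappa> = m * \<delta>\<close> is proportional to the length \<open>\<delta>\<close> of that
  interval, so that the relative size of the gaps is a geometric series starting at \<open>n1\<close>. Lengths that become
  due later have \<open>a ^ n\<close> comparable to the current interval, and then the gaps are relatively shorter by the factor
  \<open>\<kappa>\<close>, which can be made small since \<open>n1\<close> and \<open>N\<close> are chosen before \<open>\<delta>\<close>.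
\<close>
lemma intersection_has_positive_content:
  fixes m :: nat and x y s :: real
  assumes m: "2 \<le> m" and x: "0 < x" "x < 1" and y: "0 < y" "y < 1" and s: "0 < s" "s < 1"
  shows "\<exists>\<theta>>0. content_exceeds s (Lambda_set m x \<inter> Lambda_set m y) \<theta>"
proof -
  \<comment> \<open>The lower bound \<open>z0\<close> for both points gives a common bound for the widths of their gaps.\<close>
  define z0 where "z0 = min x y"
  have z0: "0 < z0" "z0 \<le> x" "z0 \<le> y" using x y by (auto simp: z0_def)
  obtain N :: nat where N: "m \<le> N" "6 * real N powr s < real N"
  proof -
    have "(\<lambda>n. real n powr (s - 1)) \<longlonglongrightarrow> 0"
      using s by (intro tendsto_neg_powr filterlim_real_sequentially) auto
    then have "\<forall>\<^sub>F n in sequentially. real n powr (s - 1) < 1 / 6" by (intro order_tendstoD(2)) auto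
    then have "\<forall>\<^sub>F n in sequentially. real n powr (s - 1) < 1 / 6 \<and> m \<le> n"
      using eventually_ge_at_top[of m] by eventually_elim auto
    then obtain n where n: "real n powr (s - 1) < 1 / 6" "m \<le> n"
      using eventually_happens by force
    have "6 * real n powr s = 6 * real n powr (s - 1) * real n"
      using n m by (simp add: powr_diff)
    also have "\<dots> < 1 * real n"
      using n m by (intro mult_strict_right_mono) auto
    also have "\<dots> = real n" by simp
    finally show thesis using n that by blast
  qed
  have N_pos: "0 < real N" and N2: "2 \<le> real N" using N m by auto
  \<comment> \<open>The constant in \<open>gap_weight_le\<close>.\<close>
  define D where "D = 6 * (2 / z0) powr s / (1 - (1 / 2) powr s)"
  have small_powr: "(\<lambda>t. D * (f t) powr s) \<longlonglongrightarrow> 0" if "f \<longlonglongrightarrow> 0" "\<And>t. 0 \<le> f t" for f :: "nat \<Rightarrow> real"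
    using s that tendsto_powr2[of f 0 sequentially "\<lambda>_. s" s] by (auto intro!: tendsto_mult_right_zero)
  \<comment> \<open>The gaps that are due at the start use up at most half of the initial budget
      \<open>(\<delta> / N) powr s\<close>, and the cover gets the other half.\<close>
  obtain n1 where n1: "1 \<le> n1" "D * (real m * (1 / 2) ^ n1) powr s \<le> (1 / real N) powr s / 2"
  proof -
    have "(\<lambda>n. real m * (1 / 2) ^ n) \<longlonglongrightarrow> 0"
      by (intro tendsto_mult_right_zero LIMSEQ_realpow_zero) auto
    then have "(\<lambda>n. D * (real m * (1 / 2) ^ n) powr s) \<longlonglongrightarrow> 0" by (rule small_powr) simp
    then have "\<forall>\<^sub>F n in sequentially. D * (real m * (1 / 2) ^ n) powr s < (1 / real N) powr s / 2"
      using N_pos by (intro order_tendstoD(2)) auto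
    then have "\<forall>\<^sub>F n in sequentially. D * (real m * (1 / 2) ^ n) powr s < (1 / real N) powr s / 2 \<and> 1 \<le> n"
      using eventually_ge_at_top[of 1] by eventually_elim auto
    then obtain n where "D * (real m * (1 / 2) ^ n) powr s < (1 / real N) powr s / 2 \<and> 1 \<le> n"
      using eventually_happens by force
    then show thesis using that by force
  qed
  define short where "short = {w. set w \<subseteq> {..<m} \<and> length w \<le> n1}"
  \<comment> \<open>The number \<open>4 * m * N\<^sup>2 * \<delta>\<close> is \<open>\<kappa>\<close> times the factor in the bound
      \<open>a ^ n < 4 * N\<^sup>2 * len k\<close> for lengths \<open>n\<close> that become due at a later stage \<open>k\<close>.\<close>
  obtain \<delta> where \<delta>: "0 < \<delta>" "\<delta> < 1 / real m" "D * (4 * real m * (real N)\<^sup>2 * \<delta>) powr s \<le> (1 / real N) powr s / 2"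
    and short_gaps: "\<And>t w. t \<in> {x, y} \<Longrightarrow> w \<in> short \<Longrightarrow> gap (real m * \<delta>) t w \<inter> {1 / real m - \<delta>..1 / real m} = {}"
  proof -
    have "finite short" unfolding short_def by (rule finite_lists_length_le) simp
    then have "\<forall>\<^sub>F \<delta> in at_right 0. \<forall>(t, w) \<in> {x, y} \<times> short.
        gap (real m * \<delta>) t w \<inter> {1 / real m - \<delta>..1 / real m} = {}"
      using gap_leaves_right_end[OF m] by (intro eventually_ball_finite) (auto simp: short_def)
    moreover have "\<forall>\<^sub>F \<delta> in at_right 0. \<delta> < 1 / real m"
      using m by (intro order_tendstoD(2)[OF tendsto_ident_at]) auto
    moreover have "\<forall>\<^sub>F \<delta> in at_right 0. D * (4 * real m * (real N)\<^sup>2 * \<delta>) powr s < (1 / real N) powr s / 2"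
    proof -
      have "((\<lambda>\<delta>. 4 * real m * (real N)\<^sup>2 * \<delta>) \<longlongrightarrow> 0) (at_right 0)"
        by (rule tendsto_mult_right_zero) (rule tendsto_ident_at)
      then have "((\<lambda>\<delta>. (4 * real m * (real N)\<^sup>2 * \<delta>) powr s) \<longlongrightarrow> 0 powr s) (at_right 0)"
        using s by (intro tendsto_powr2 tendsto_const) (auto simp: eventually_at_right_field intro: exI[of _ 1])
      then have "((\<lambda>\<delta>. D * (4 * real m * (real N)\<^sup>2 * \<delta>) powr s) \<longlongrightarrow> 0) (at_right 0)"
        by (intro tendsto_mult_right_zero) simp
      then show ?thesis using N_pos by (intro order_tendstoD(2)) auto
    qed
    moreover have "\<forall>\<^sub>F \<delta> in at_right (0 :: real). 0 < \<delta>" by (rule eventually_at_right_less)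
    ultimately have "\<forall>\<^sub>F \<delta> in at_right 0. 0 < \<delta> \<and> \<delta> < 1 / real m \<and>
        D * (4 * real m * (real N)\<^sup>2 * \<delta>) powr s \<le> (1 / real N) powr s / 2 \<and>
        (\<forall>(t, w) \<in> {x, y} \<times> short. gap (real m * \<delta>) t w \<inter> {1 / real m - \<delta>..1 / real m} = {})"
      by eventually_elim auto
    then show thesis using eventually_happens that by (smt (verit) SigmaI case_prodD trivial_limit_at_right_real)
  qed
  define \<kappa> where "\<kappa> = real m * \<delta>"
  have \<kappa>: "0 < \<kappa>" "\<kappa> \<le> 1" using \<delta> m by (auto simp: \<kappa>_def field_simps)
  define a0 where "a0 = 1 / real m - \<delta>"
  have a0: "0 < a0" "a0 + \<delta> = 1 / real m" using \<delta> by (auto simp: a0_def)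
  define len where "len k = \<delta> / real N ^ k" for k
  have len: "0 < len k" "len k = real N * len (Suc k)" for k using \<delta> N_pos by (auto simp: len_def)
  have len_0: "len 0 = \<delta>" by (simp add: len_def)
  define c where "c = 1 / (2 * real N)"
  have c: "0 < c" "real N * c = 1 / 2" using N_pos by (auto simp: c_def)
  have "content_exceeds s (Lambda_set m x \<inter> Lambda_set m y) ((\<delta> / real N) powr s / 2)"
    unfolding content_exceeds_def
  proof (intro allI impI, rule ccontr)
    fix U :: "nat \<Rightarrow> real set" and r
    assume "\<forall>i. 0 < r i" and "\<forall>i. \<forall>u\<in>U i. \<forall>v\<in>U i. u \<le> v \<longrightarrow> v - u \<le> r i"
      and covered: "Lambda_set m x \<inter> Lambda_set m y \<subseteq> (\<Union>i. U i)"
      and "\<not> ennreal ((\<delta> / real N) powr s / 2) < (\<Sum>i. ennreal (r i powr s))"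
    then have r: "\<And>i. 0 < r i" and U: "\<And>i u v. u \<in> U i \<Longrightarrow> v \<in> U i \<Longrightarrow> u \<le> v \<Longrightarrow> v - u \<le> r i"
      and sum_r: "(\<Sum>i. ennreal (r i powr s)) \<le> ennreal ((\<delta> / real N) powr s / 2)"
      by (simp_all add: not_less)
    \<comment> \<open>Stage \<open>0\<close> has no upper bound on \<open>a ^ n\<close>: it takes all lengths that are due at the start. Later,
        the factor \<open>2 * N\<close> leaves room for the division of the interval by \<open>N\<close> and for
        the change of \<open>a ^ n\<close> from one stage to the next, so that no length is skipped.\<close>
    define due where "due k a n \<longleftrightarrow> n1 \<le> n \<and> len k \<le> c * a ^ n \<and> (0 < k \<longrightarrow> c * a ^ n < 2 * real N * len k)"
      for k :: nat and a :: real and n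
    define Q where "Q k a = {(t, w). t \<in> {x, y} \<and> set w \<subseteq> {..<m} \<and> due k a (length w)
        \<and> gap \<kappa> t w \<inter> {a..a + len k} \<noteq> {}}" for k and a :: real
    \<comment> \<open>An obstacle coming from a gap is the part of the gap inside the interval at which it appears.
        Its index records this interval, since the width is bounded in terms of it.\<close>
    define A where "A i = (case i of Inl j \<Rightarrow> U j | Inr (k, a, t, w) \<Rightarrow> gap \<kappa> t w \<inter> {a..a + len k})"
      for i :: "nat + nat \<times> real \<times> real \<times> nat list"
    define \<rho> where "\<rho> i = (case i of Inl j \<Rightarrow> r j | Inr (k, a, t, w) \<Rightarrow> \<kappa> * (a + len k) ^ length w / t)"
      for i :: "nat + nat \<times> real \<times> real \<times> nat list"
    define gaps where "gaps k a = (\<lambda>(t, w). Inr (k, a, t, w) :: nat + nat \<times> real \<times> real \<times> nat list) ` Q k a"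
      for k and a :: real
    define New where "New k a = (if k = 0 then range Inl else {}) \<union> gaps k a" for k and a :: real
    have window: "0 < a" "a + len k \<le> 1" "real m * (a + len k) \<le> 1" if "a0 \<le> a" "a + len k \<le> a0 + \<delta>" for k a
    proof -
      show "0 < a" using that a0 by linarith
      have "a + len k \<le> 1 / real m" using that a0 by linarith
      then show "real m * (a + len k) \<le> 1" using m by (simp add: field_simps)
      have "1 / real m \<le> 1" using m by simp
      then show "a + len k \<le> 1" using \<open>a + len k \<le> 1 / real m\<close> by linarith
    qed
    have New_cases: "(\<exists>j. i = Inl j) \<or> (\<exists>t w. i = Inr (k, a, t, w) \<and> (t, w) \<in> Q k a)" if "i \<in> New k a" for i k a
      using that by (auto simp: New_def gaps_def split: if_splits)
    have gaps_weight: "(\<integral>\<^sup>+i. ennreal (\<rho> i powr s) \<partial>count_space (gaps k a)) \<le> ennreal (D * (\<kappa> * B) powr s)"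
      if a: "a0 \<le> a" "a + len k \<le> a0 + \<delta>" and B: "\<And>n. due k a n \<Longrightarrow> a ^ n \<le> B" "0 < B" for k a B
    proof -
      have due: "len k \<le> a ^ n / (2 * real N)" if "due k a n" for n
        using that by (simp add: due_def c_def)
      have N': "real m \<le> real N" using N by simp
      note weight = gap_weight_le[where P = "due k a", OF window(1)[OF a] len(1)[of k] window(3)[OF a]
          m \<kappa> s(1) z0 N' due B]
      have fin: "finite (Q k a)" unfolding Q_def by (rule weight(1))
      have "(\<integral>\<^sup>+i. ennreal (\<rho> i powr s) \<partial>count_space (gaps k a)) = (\<Sum>i\<in>gaps k a. ennreal (\<rho> i powr s))"
        using fin by (intro nn_integral_count_space_finite) (simp add: gaps_def)
      also have "\<dots> = ennreal (\<Sum>i\<in>gaps k a. \<rho> i powr s)" by simp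
      also have "(\<Sum>i\<in>gaps k a. \<rho> i powr s) = (\<Sum>(t, w)\<in>Q k a. (\<kappa> * (a + len k) ^ length w / t) powr s)"
        unfolding gaps_def by (subst sum.reindex) (auto simp: inj_on_def \<rho>_def intro!: sum.cong)
      also have "\<dots> \<le> D * (\<kappa> * B) powr s"
        unfolding D_def Q_def by (rule weight(2))
      finally show ?thesis by (simp add: ennreal_leI)
    qed
    have width: "0 < \<rho> i" "u \<in> A i \<Longrightarrow> v \<in> A i \<Longrightarrow> u \<le> v \<Longrightarrow> v - u \<le> \<rho> i"
      if a: "a0 \<le> a" "a + \<delta> / real N ^ k \<le> a0 + \<delta>" and i: "i \<in> New k a" for k a i u v
    proof -
      note win = window[of a k, unfolded len_def, OF a, folded len_def]
      consider j where "i = Inl j" | t w where "i = Inr (k, a, t, w)" "(t, w) \<in> Q k a"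
        using New_cases[OF i] by blast
      then have "0 < \<rho> i \<and> (u \<in> A i \<longrightarrow> v \<in> A i \<longrightarrow> u \<le> v \<longrightarrow> v - u \<le> \<rho> i)"
      proof cases
        case 1
        then show ?thesis using r U by (auto simp: \<rho>_def A_def)
      next
        case 2
        then have t: "0 < t" and w: "w \<noteq> []" using x y n1 by (auto simp: Q_def due_def)
        have "v - u \<le> \<kappa> * (a + len k) ^ length w / t"
          if u: "u \<in> gap \<kappa> t w" "a \<le> u" "u \<le> a + len k" and v: "v \<in> gap \<kappa> t w" "v \<le> a + len k" "u \<le> v"
        proof -
          have "v - u \<le> \<kappa> * u ^ length w / t"
            using u v win t w \<kappa> by (intro gap_diameter) auto
          also have "\<dots> \<le> \<kappa> * (a + len k) ^ length w / t"
            using u win t \<kappa> by (intro divide_right_mono mult_left_mono power_mono) auto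
          finally show ?thesis .
        qed
        moreover have "0 < a + len k" using win(1) len(1)[of k] by linarith
        ultimately show ?thesis using 2 t \<kappa> by (auto simp: \<rho>_def A_def)
      qed
      then show "0 < \<rho> i" "u \<in> A i \<Longrightarrow> v \<in> A i \<Longrightarrow> u \<le> v \<Longrightarrow> v - u \<le> \<rho> i" by auto
    qed
    have half_pow: "a ^ n \<le> (1 / 2) ^ n1" if "0 < a" "a \<le> 1 / 2" "n1 \<le> n" for a :: real and n
    proof -
      have "a ^ n \<le> a ^ n1" using that by (intro power_decreasing) auto
      also have "\<dots> \<le> (1 / 2) ^ n1" using that by (intro power_mono) auto
      finally show ?thesis .
    qed
    have new_0: "(\<integral>\<^sup>+i. ennreal (\<rho> i powr s) \<partial>count_space (New 0 a0)) \<le> ennreal ((\<delta> / real N) powr s)"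
    proof -
      have a0_half: "a0 \<le> 1 / 2"
      proof -
        have "1 / real m \<le> 1 / 2" using m by (intro divide_left_mono) auto
        then show ?thesis using a0 \<delta> by linarith
      qed
      define h where "h = (\<delta> / real N) powr s / 2"
      have "bij_betw (Inl :: nat \<Rightarrow> nat + nat \<times> real \<times> real \<times> nat list) UNIV (range Inl)"
        by (auto simp: bij_betw_def)
      from nn_integral_bij_count_space[OF this, of "\<lambda>i. ennreal (\<rho> i powr s)"]
      have covering: "(\<integral>\<^sup>+i. ennreal (\<rho> i powr s) \<partial>count_space (range Inl)) \<le> ennreal h"
        using sum_r by (simp add: \<rho>_def nn_integral_count_space_nat h_def)
      have "D * (\<kappa> * (1 / 2) ^ n1) powr s = D * (real m * (1 / 2) ^ n1) powr s * \<delta> powr s"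
        by (simp add: \<kappa>_def powr_mult mult_ac)
      also have "\<dots> \<le> ((1 / real N) powr s / 2) * \<delta> powr s"
        using n1 by (intro mult_right_mono) auto
      also have "\<dots> = h" using \<delta> N_pos by (simp add: h_def powr_divide)
      finally have budget: "D * (\<kappa> * (1 / 2) ^ n1) powr s \<le> h" .
      have "(\<integral>\<^sup>+i. ennreal (\<rho> i powr s) \<partial>count_space (gaps 0 a0)) \<le> ennreal (D * (\<kappa> * (1 / 2) ^ n1) powr s)"
        using a0 a0_half by (intro gaps_weight half_pow) (auto simp: len_0 due_def)
      also have "\<dots> \<le> ennreal h" using budget by (rule ennreal_leI)
      finally have "(\<integral>\<^sup>+i. ennreal (\<rho> i powr s) \<partial>count_space (range Inl)) +
          (\<integral>\<^sup>+i. ennreal (\<rho> i powr s) \<partial>count_space (gaps 0 a0)) \<le> ennreal h + ennreal h"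
        using covering by (intro add_mono)
      moreover have "ennreal h + ennreal h = ennreal ((\<delta> / real N) powr s)"
        by (simp add: h_def ennreal_plus[symmetric] del: ennreal_plus)
      moreover have "New 0 a0 = range Inl \<union> gaps 0 a0" by (simp add: New_def)
      ultimately show ?thesis
        using nn_integral_count_space_Un_le[of "range Inl" "gaps 0 a0" "\<lambda>i. ennreal (\<rho> i powr s)"] by simp
    qed
    have new_Suc: "(\<integral>\<^sup>+i. ennreal (\<rho> i powr s) \<partial>count_space (New (Suc k) a))
        \<le> ennreal ((\<delta> / real N ^ Suc (Suc k)) powr s / 2)"
      if a: "a0 \<le> a" "a + \<delta> / real N ^ Suc k \<le> a0 + \<delta>" for k a
    proof -
      let ?l = "len (Suc k)"
      have "(\<integral>\<^sup>+i. ennreal (\<rho> i powr s) \<partial>count_space (New (Suc k) a))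
          \<le> ennreal (D * (\<kappa> * (4 * (real N)\<^sup>2 * ?l)) powr s)"
      proof -
        have "a ^ n \<le> 4 * (real N)\<^sup>2 * ?l" if "due (Suc k) a n" for n
          using that N_pos by (simp add: due_def c_def field_simps power2_eq_square)
        then show ?thesis using a len(1)[of "Suc k"] N_pos unfolding New_def
          by (simp only: nat.distinct if_False Un_empty_left) (intro gaps_weight, auto simp: len_def)
      qed
      also have "D * (\<kappa> * (4 * (real N)\<^sup>2 * ?l)) powr s = D * (4 * real m * (real N)\<^sup>2 * \<delta>) powr s * ?l powr s"
        using \<delta> len(1)[of "Suc k"] by (simp add: \<kappa>_def powr_mult mult_ac)
      also have "\<dots> \<le> ((1 / real N) powr s / 2) * ?l powr s"
        using \<delta> by (intro mult_right_mono) auto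
      also have "\<dots> = (1 / real N * ?l) powr s / 2"
        by (simp only: powr_mult)
      also have "1 / real N * ?l = \<delta> / real N ^ Suc (Suc k)" by (simp add: len_def)
      finally show ?thesis by (simp add: ennreal_leI)
    qed
    obtain a z where a_0: "a 0 = a0" and a_step: "\<And>k. a k \<le> a (Suc k)"
        "\<And>k. a (Suc k) + len (Suc k) \<le> a k + len k"
      and z: "\<And>k. z \<in> {a k..a k + len k}" and avoid: "\<And>k i. i \<in> New k (a k) \<Longrightarrow> z \<notin> A i"
    proof -
      show thesis
        by (rule potential_game[where A = A and \<rho> = \<rho> and New = New, OF N(2) s(1) \<delta>(1)],
            fact width(1), fact width(2), fact new_0, fact new_Suc)
           (rule that[unfolded len_def]; assumption)
    qed
    have a_ge: "a0 \<le> a k" for k by (induction k) (use a_0 a_step order_trans in \<open>auto intro: order_trans\<close>)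
    have a_le: "a k + len k \<le> 1 / real m" for k
      by (induction k) (use a_0 a0 len_0 a_step(2) in \<open>auto intro: order_trans\<close>)
    have z_range: "a0 \<le> z" "z \<le> 1 / real m" using z[of 0] a_ge[of 0] a_le[of 0] by auto
    have z_gap: "z \<notin> gap \<kappa> t w" if t: "t \<in> {x, y}" and w: "set w \<subseteq> {..<m}" for t w
    proof (cases "length w < n1")
      case True
      then show ?thesis using short_gaps[OF t, of w] w z_range by (auto simp: short_def \<kappa>_def a0_def)
    next
      case False
      define n where "n = length w"
      have n: "n1 \<le> n" using False by (simp add: n_def)
      have "\<exists>k. len k \<le> c * a k ^ n"
      proof -
        have "(\<lambda>k. \<delta> * (1 / real N) ^ k) \<longlonglongrightarrow> \<delta> * 0"
          using N2 by (intro tendsto_mult tendsto_const LIMSEQ_realpow_zero) auto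
        then have "len \<longlonglongrightarrow> 0" by (simp add: len_def[abs_def] power_divide)
        then have "\<forall>\<^sub>F k in sequentially. len k < c * a0 ^ n"
          using c a0 by (intro order_tendstoD(2)) auto
        then obtain k where "len k < c * a0 ^ n" using eventually_happens by force
        also have "c * a0 ^ n \<le> c * a k ^ n"
          using c a0 a_ge by (intro mult_left_mono power_mono) auto
        finally show ?thesis by (blast intro: less_imp_le)
      qed
      \<comment> \<open>The first stage at which the length of the word is due is one at which its gap is introduced.\<close>
      then obtain k where k: "len k \<le> c * a k ^ n" and k_least: "\<And>j. j < k \<Longrightarrow> \<not> len j \<le> c * a j ^ n"
        using exists_least_iff[of "\<lambda>k. len k \<le> c * a k ^ n"] by blast
      have "c * a k ^ n < 2 * real N * len k" if pos: "0 < k"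
      proof -
        obtain j where j: "k = Suc j" using pos by (cases k) auto
        define b where "b = a k"
        have b: "0 < b" "b \<le> 1 / 2"
        proof -
          show "0 < b" using a_ge[of k] a0 by (simp add: b_def)
          have "1 / real m \<le> 1 / 2" using m by (intro divide_left_mono) auto
          then show "b \<le> 1 / 2" using a_le[of k] len(1)[of k] by (simp add: b_def)
        qed
        have h: "real N * len k \<le> 1 / 2 * b ^ n"
        proof -
          have "real N * len k \<le> real N * (c * b ^ n)" using k N_pos by (simp add: b_def)
          then show ?thesis using c(2) by (simp add: mult.assoc[symmetric])
        qed
        have "b ^ n \<le> b" using b n n1 power_decreasing[of 1 n b] by auto
        then have "real N * len k \<le> b" using h b by linarith
        then have "(1 - 1 / 2) * b ^ n \<le> (b - real N * len k) ^ n"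
          using b h N_pos len(1)[of k] by (intro power_shrink) auto
        also have "\<dots> \<le> a j ^ n"
          using a_step(2)[of j] len(2)[of j] len(1)[of k] \<open>real N * len k \<le> b\<close>
          by (intro power_mono) (auto simp: j b_def)
        finally have "c * (1 / 2 * b ^ n) \<le> c * a j ^ n" using c by (intro mult_left_mono) auto
        also have "\<dots> < real N * len k" using k_least[of j] len(2)[of j] by (simp add: j)
        finally show ?thesis by (simp add: b_def)
      qed
      then have due: "due k (a k) (length w)" using n k by (auto simp: due_def n_def)
      show ?thesis
      proof
        assume "z \<in> gap \<kappa> t w"
        then have "(t, w) \<in> Q k (a k)" and zA: "z \<in> A (Inr (k, a k, t, w))"
          using t w due z[of k] by (auto simp: Q_def A_def)
        then have "Inr (k, a k, t, w) \<in> New k (a k)" by (force simp: New_def gaps_def)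
        then show False using avoid zA by blast
      qed
    qed
    have mz: "0 < z" "real m * z \<le> 1" "1 - \<kappa> \<le> real m * z"
    proof -
      show "0 < z" using z_range a0 by linarith
      show "real m * z \<le> 1" using z_range m by (simp add: field_simps)
      have "real m * a0 \<le> real m * z" using z_range by (intro mult_left_mono) auto
      moreover have "real m * a0 = 1 - \<kappa>" using m by (simp add: a0_def \<kappa>_def field_simps)
      ultimately show "1 - \<kappa> \<le> real m * z" by simp
    qed
    have "z \<in> Lambda_set m t" if "t \<in> {x, y}" for t
      using mem_K_set_if_no_gap[OF mz m, of t] z_gap[OF that] that x y z_range mz
      by (auto simp: Lambda_set_def)
    then have "z \<in> Lambda_set m x \<inter> Lambda_set m y" by auto
    moreover have "z \<notin> U i" for i
      using avoid[of "Inl i" 0] by (auto simp: New_def A_def)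
    ultimately show False using covered by blast
  qed
  moreover have "0 < (\<delta> / real N) powr s / 2" using \<delta> N_pos by simp
  ultimately show ?thesis by blast
qed

theorem theorem1p6:
  fixes m :: nat and x y :: real
  assumes "m \<ge> 2" and "x \<in> {0<..<1}" and "y \<in> {0<..<1}"
  shows "hausdorff_dim (Lambda_set m x \<inter> Lambda_set m y) = 1"
proof (rule antisym)
  have "1 / real m \<le> 1" using assms(1) by simp
  then have "Lambda_set m x \<inter> Lambda_set m y \<subseteq> {0..1}" by (force simp: Lambda_set_def)
  then show "hausdorff_dim (Lambda_set m x \<inter> Lambda_set m y) \<le> 1" by (rule hausdorff_dim_le_1)
next
  have large: "hausdorff_measure s (Lambda_set m x \<inter> Lambda_set m y) \<noteq> 0" if s: "0 \<le> s" "s < 1" for s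
  proof -
    define t where "t = max s (1 / 2)"
    have t: "0 < t" "t < 1" "s \<le> t" using s by (auto simp: t_def)
    obtain \<theta> where "0 < \<theta>" "content_exceeds t (Lambda_set m x \<inter> Lambda_set m y) \<theta>"
      using intersection_has_positive_content[of m x y t] assms t by auto
    then show ?thesis using s t by (intro hausdorff_measure_nonzero_if_content) auto
  qed
  show "1 \<le> hausdorff_dim (Lambda_set m x \<inter> Lambda_set m y)"
    unfolding hausdorff_dim_def
  proof (intro INF_greatest)
    fix s assume "s \<in> {s. 0 \<le> s \<and> hausdorff_measure s (Lambda_set m x \<inter> Lambda_set m y) = 0}"
    then have "1 \<le> s" using large[of s] by fastforce
    then show "1 \<le> ennreal s" by simp
  qed
qed

end
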